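(* Let $f=h+P$ be a proper closed function on $\mathbb{R}^n$, where $h$ is a proper closed (possibly nonconvex) function with an open domain that is continuously differentiable with a locally Lipschitz continuous gradient on $\mathrm{dom}\,h$, and $P$ is a proper closed convex function. Let $\mathcal{X}$ be the set of stationary points of $f$, and suppose that $\mathcal{X}\neq\emptyset$. Suppose that for any $\bar x\in\mathcal{X}$ there exists $\delta>0$ such that $f(y)=f(\bar x)$ whenever $y\in\mathcal{X}$ and $\|y-\bar x\|\le\delta$. Suppose also that the Luo-Tseng error bound holds for $f$. Then $f$ is a KL function with an exponent of $\frac12$.
   Context: Closed means lower semicontinuous; proper means never $-\infty$ and not identically $+\infty$; $\mathrm{dom}\,f=\{x: f(x)<\infty\}$. For a proper function $f$ and $x\in\mathrm{dom}\,f$, the regular subdifferential is $\widehat\partial f(x)=\{v: \liminf_{z\to x,z\ne x}\frac{f(z)-f(x)-\langle v,z-x\rangle}{\|z-x\|}\ge 0\}$ and the (limiting) subdifferential $\partial f(x)$ is the set of $v$ for which there exist $x^t\to x$ with $f(x^t)\to f(x)$ and $v^t\to v$ with $v^t\in\widehat\partial f(x^t)$ for each $t$; $\partial f(x)=\emptyset$ if $x\notin\mathrm{dom}\,f$. $\mathrm{dom}\,\partial f=\{x:\partial f(x)\ne\emptyset\}$. A stationary point of $f$ is an $x$ with $0\in\partial f(x)$. Proximal mapping: $\mathrm{prox}_P(z)=\arg\min_{x}\{P(x)+\frac12\|x-z\|^2\}$. Luo-Tseng error bound (for $f=h+P$ with $\mathcal{X}\ne\emptyset$): for any $\zeta\ge\inf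 f$ there exist $c,\epsilon>0$ such that $\mathrm{dist}(x,\mathcal{X})\le c\,\|\mathrm{prox}_P(x-\nabla h(x))-x\|$ whenever $\|\mathrm{prox}_P(x-\nabla h(x))-x\|<\epsilon$ and $f(x)\le\zeta$. A proper closed function $f$ has the KL property at $\bar x\in\mathrm{dom}\,\partial f$ with an exponent of $\alpha\in[0,1)$ if there exist $c,\epsilon>0$ and $\nu\in(0,\infty]$ such that $\mathrm{dist}(0,\partial f(x))\ge c\,(f(x)-f(\bar x))^\alpha$ whenever $\|x-\bar x\|\le\epsilon$ and $f(\bar x)<f(x)<f(\bar x)+\nu$ (with $\mathrm{dist}(0,\emptyset)=+\infty$). It is a KL function with an exponent of $\alpha$ if it has the KL property with exponent $\alpha$ at every $\bar x\in\mathrm{dom}\,\partial f$. *)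

theory Defs
  imports "HOL-Analysis.Analysis"
begin

definition edom :: "('a \<Rightarrow> ereal) \<Rightarrow> 'a set" where
  "edom f = {x. f x < \<infinity>}"

definition proper_fun :: "('a \<Rightarrow> ereal) \<Rightarrow> bool" where
  "proper_fun f \<longleftrightarrow> (\<forall>x. f x \<noteq> -\<infinity>) \<and> (\<exists>x. f x \<noteq> \<infinity>)"

definition closed_fun :: "('a::topological_space \<Rightarrow> ereal) \<Rightarrow> bool" where
  "closed_fun f \<longleftrightarrow> (\<forall>x. f x \<le> Liminf (at x) f)"

(* Only weights in the open interval (0,1) occur, so the convention 0 * \<infinity> = 0
   plays no role. *)
definition convex_fun :: "('a::real_vector \<Rightarrow> ereal) \<Rightarrow> bool" where
  "convex_fun f \<longleftrightarrow>
    (\<forall>x y. \<forall>t. 0 < t \<and> t < 1 \<longrightarrow>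
      f ((1 - t) *\<^sub>R x + t *\<^sub>R y) \<le> ereal (1 - t) * f x + ereal t * f y)"

definition regular_subdiff :: "('a::real_inner \<Rightarrow> ereal) \<Rightarrow> 'a \<Rightarrow> 'a set" where
  "regular_subdiff f x = {v. x \<in> edom f \<and>
     0 \<le> Liminf (at x) (\<lambda>z. (f z - f x - ereal (v \<bullet> (z - x))) / ereal (norm (z - x)))}"

definition subdiff :: "('a::real_inner \<Rightarrow> ereal) \<Rightarrow> 'a \<Rightarrow> 'a set" where
  "subdiff f x = {v. x \<in> edom f \<and>
     (\<exists>xs vs. xs \<longlonglongrightarrow> x \<and> (\<lambda>t. f (xs t)) \<longlonglongrightarrow> f x \<and> vs \<longlonglongrightarrow> v \<and>
        (\<forall>t::nat. vs t \<in> regular_subdiff f (xs t)))}"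

definition stationary_points :: "('a::real_inner \<Rightarrow> ereal) \<Rightarrow> 'a set" where
  "stationary_points f = {x. 0 \<in> subdiff f x}"

(* The minimiser exists and is unique when P is proper, closed and convex on a
   Euclidean space; only then is this the usual proximal mapping. *)
definition prox :: "('a::real_normed_vector \<Rightarrow> ereal) \<Rightarrow> 'a \<Rightarrow> 'a" where
  "prox P z = (ARG_MIN (\<lambda>x. P x + ereal (1/2 * (norm (x - z))\<^sup>2)) x. True)"

(* Meaningful only at points near which h is finite and at which it is differentiable. *)
definition grad :: "('a::real_inner \<Rightarrow> ereal) \<Rightarrow> 'a \<Rightarrow> 'a" where
  "grad h x = (THE g. GDERIV (\<lambda>y. real_of_ereal (h y)) x :> g)"

definition smooth_on_dom :: "('a::real_inner \<Rightarrow> ereal) \<Rightarrow> bool" where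
  "smooth_on_dom h \<longleftrightarrow>
    (\<forall>x\<in>edom h. \<exists>g. GDERIV (\<lambda>y. real_of_ereal (h y)) x :> g) \<and>
    continuous_on (edom h) (grad h) \<and>
    (\<forall>x\<in>edom h. \<exists>\<delta>>0. \<exists>L. L-lipschitz_on (ball x \<delta> \<inter> edom h) (grad h))"

(* Points with h x + P x \<le> \<zeta> < \<infinity> lie in the domain of h, so grad h x is meaningful below.
   To be used only when stationary points exist: infdist to the empty set is 0. *)
definition luo_tseng_error_bound ::
  "('a::real_inner \<Rightarrow> ereal) \<Rightarrow> ('a \<Rightarrow> ereal) \<Rightarrow> bool" where
  "luo_tseng_error_bound h P \<longleftrightarrow>
    (\<forall>\<zeta>::real. (INF x. h x + P x) \<le> ereal \<zeta> \<longrightarrow>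
      (\<exists>c>0. \<exists>\<epsilon>>0. \<forall>x.
        norm (prox P (x - grad h x) - x) < \<epsilon> \<and> h x + P x \<le> ereal \<zeta> \<longrightarrow>
        infdist x (stationary_points (\<lambda>x. h x + P x)) \<le> c * norm (prox P (x - grad h x) - x)))"

(* Extended-valued so that the distance to the empty set is \<infinity> (infdist would give 0). *)
definition einfdist :: "'a::metric_space \<Rightarrow> 'a set \<Rightarrow> ereal" where
  "einfdist x S = (INF y\<in>S. ereal (dist x y))"

(* The value differences raised to the power \<alpha> are finite and positive, so passing
   through real_of_ereal and powr is harmless, also for \<alpha> = 0. *)
definition KL_property_at :: "('a::real_inner \<Rightarrow> ereal) \<Rightarrow> real \<Rightarrow> 'a \<Rightarrow> bool" where
  "KL_property_at f \<alpha> xbar \<longleftrightarrow>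
    (\<exists>c>0. \<exists>\<epsilon>>0. \<exists>\<nu>::ereal. 0 < \<nu> \<and>
      (\<forall>x. norm (x - xbar) \<le> \<epsilon> \<and> f xbar < f x \<and> f x < f xbar + \<nu> \<longrightarrow>
        ereal (c * real_of_ereal (f x - f xbar) powr \<alpha>) \<le> einfdist 0 (subdiff f x)))"

definition KL_function :: "('a::real_inner \<Rightarrow> ereal) \<Rightarrow> real \<Rightarrow> bool" where
  "KL_function f \<alpha> \<longleftrightarrow>
    proper_fun f \<and> closed_fun f \<and> 0 \<le> \<alpha> \<and> \<alpha> < 1 \<and>
    (\<forall>xbar. subdiff f xbar \<noteq> {} \<longrightarrow> KL_property_at f \<alpha> xbar)"

end

theory Submission
  imports Defs
begin

text \<open>
  Since \<open>h\<close> is smooth and \<open>P\<close> is convex, \<open>v\<close> is a subgradient of \<open>f = h + P\<close> at \<open>x\<close> exactly when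
  \<open>v - \<nabla>h(x)\<close> is a subgradient of \<open>P\<close> at \<open>x\<close> in the sense of convex analysis
  (\<open>regular_subdiff_add_smooth\<close>, \<open>convex_regular_subdiff_iff\<close>). Because \<open>P\<close> is lower
  semicontinuous and \<open>\<nabla>h\<close> is continuous, such subgradients pass to limits, so the limiting
  subdifferential of \<open>f\<close> is just the regular one (\<open>subdiff_add_smooth_convex\<close>).

  Near a point \<open>xbar\<close> that is not stationary, the same limit argument keeps the subgradients of
  \<open>f\<close> away from \<open>0\<close>, and the inequality holds with any exponent
  (\<open>KL_property_at_nonstationary\<close>).

  Let \<open>xbar\<close> be stationary, \<open>x\<close> near \<open>xbar\<close> with \<open>f(x)\<close> slightly above \<open>f(xbar)\<close>, and \<open>v\<close> a
  subgradient of \<open>f\<close> at \<open>x\<close>. Then \<open>x = prox\<^sub>P(x + v - \<nabla>h(x))\<close>, and nonexpansiveness of the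
  proximal mapping bounds the residual \<open>\<parallel>prox\<^sub>P(x - \<nabla>h(x)) - x\<parallel>\<close> by \<open>\<parallel>v\<parallel>\<close>
  (\<open>prox_residual_le\<close>). If \<open>\<parallel>v\<parallel>\<close> is small, the error bound therefore yields a stationary point
  \<open>z\<close> with \<open>\<parallel>x - z\<parallel> < 2c\<parallel>v\<parallel>\<close>. This \<open>z\<close> is still close to \<open>xbar\<close>, so \<open>f(z) = f(xbar)\<close> because
  \<open>f\<close> is locally constant on the stationary points. Convexity of \<open>P\<close> and the Lipschitz gradient of \<open>h\<close> give
  \<open>f(x) - f(z) \<le> \<parallel>v\<parallel>\<parallel>x - z\<parallel> + L\<parallel>x - z\<parallel>\<^sup>2\<close> (\<open>smooth_convex_gap_le\<close>). Both terms are of order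
  \<open>\<parallel>v\<parallel>\<^sup>2\<close>, which is where the exponent \<open>1/2\<close> comes from. If \<open>\<parallel>v\<parallel>\<close> is not small, the inequality is
  trivial because only gaps \<open>f(x) - f(xbar) < 1\<close> are considered.
\<close>

section \<open>Lower semicontinuity and regular subgradients\<close>

text \<open>
  The limit inferior in \<open>closed_fun\<close> runs over punctured neighbourhoods, whereas a sequence may
  hit its limit; the value at the limit point is therefore brought in separately.
\<close>

lemma closed_fun_limit_le:
  fixes f :: "'a::topological_space \<Rightarrow> ereal"
  assumes "closed_fun f" "xs \<longlonglongrightarrow> x" "a \<longlonglongrightarrow> l"
    and le: "\<And>k::nat. f (xs k) \<le> a k"
  shows "f x \<le> l"
proof (rule ccontr)
  assume "\<not> f x \<le> l"
  then have "l < f x" by simp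
  then obtain c where c: "l < c" "c < f x"
    using dense by blast
  have "c < Liminf (at x) f"
    using assms(1) c(2) unfolding closed_fun_def by (meson less_le_trans)
  then have "eventually (\<lambda>z. c < f z) (at x)"
    using less_LiminfD by blast
  then have "eventually (\<lambda>z. c < f z) (nhds x)"
    using c(2) by (auto simp: eventually_at_filter elim: eventually_mono)
  then have "eventually (\<lambda>k. c < f (xs k)) sequentially"
    using assms(2) by (auto simp: filterlim_iff)
  then have "eventually (\<lambda>k. c \<le> a k) sequentially"
    by (rule eventually_mono) (meson le less_imp_le less_le_trans)
  then have "c \<le> l"
    using assms(3) tendsto_lowerbound trivial_limit_sequentially by blast
  with c(1) show False by simp
qed

text \<open>
  Multiplying out the difference quotient makes a regular subgradient a first-order minorant up to
  an error \<open>e * norm (z - x)\<close>, with every \<open>e > 0\<close>. In this form the sum rule and the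
  convex case need no arithmetic with infinite quotients.
\<close>

lemma regular_subdiff_iff:
  fixes f :: "'a::real_inner \<Rightarrow> ereal"
  assumes "\<And>z. f z \<noteq> -\<infinity>"
  shows "v \<in> regular_subdiff f x \<longleftrightarrow>
    x \<in> edom f \<and>
    (\<forall>e>0. \<forall>\<^sub>F z in at x. f x + ereal (v \<bullet> (z - x) - e * norm (z - x)) \<le> f z)"
    (is "_ \<longleftrightarrow> _ \<and> ?R")
proof (cases "x \<in> edom f")
  case False
  then show ?thesis by (simp add: regular_subdiff_def)
next
  case True
  define q where
    "q z = (f z - f x - ereal (v \<bullet> (z - x))) / ereal (norm (z - x))" for z
  obtain r where r: "f x = ereal r"
    using True assms[of x] by (cases "f x") (auto simp: edom_def)
  have q_le: "ereal (- e) \<le> q z \<longleftrightarrow> f x + ereal (v \<bullet> (z - x) - e * norm (z - x)) \<le> f z"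
    if "z \<noteq> x" for e z
  proof (cases "f z")
    case (real s)
    have "- e \<le> (s - r - v \<bullet> (z - x)) / norm (z - x) \<longleftrightarrow>
        r + (v \<bullet> (z - x) - e * norm (z - x)) \<le> s"
      using that by (simp add: pos_le_divide_eq algebra_simps)
    then show ?thesis
      using that real r by (simp add: q_def)
  next
    case PInf
    then show ?thesis
      using that r by (simp add: q_def)
  next
    case MInf
    then show ?thesis using assms by simp
  qed
  have "0 \<le> Liminf (at x) q \<longleftrightarrow> (\<forall>e>0. \<forall>\<^sub>F z in at x. ereal (- e) \<le> q z)"
  proof
    assume L: "0 \<le> Liminf (at x) q"
    show "\<forall>e>0. \<forall>\<^sub>F z in at x. ereal (- e) \<le> q z"
    proof (intro allI impI)
      fix e :: real
      assume "0 < e"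
      then have "ereal (- e) < 0" by simp
      then have "\<forall>\<^sub>F z in at x. ereal (- e) < q z"
        using L unfolding le_Liminf_iff by blast
      then show "\<forall>\<^sub>F z in at x. ereal (- e) \<le> q z"
        by (rule eventually_mono) simp
    qed
  next
    assume R: "\<forall>e>0. \<forall>\<^sub>F z in at x. ereal (- e) \<le> q z"
    show "0 \<le> Liminf (at x) q"
      unfolding le_Liminf_iff
    proof (intro allI impI)
      fix y :: ereal
      assume "y < 0"
      then obtain b where b: "y < ereal b" "ereal b < 0"
        using ereal_dense2 by blast
      then have "\<forall>\<^sub>F z in at x. ereal (- (- b)) \<le> q z"
        using R by (metis ereal_less(2) ereal_less_eq(3) less_ereal.simps(1) neg_0_less_iff_less zero_ereal_def)
      then show "\<forall>\<^sub>F z in at x. y < q z"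
        by (rule eventually_mono) (use b(1) in \<open>auto intro: less_le_trans\<close>)
    qed
  qed
  also have "\<dots> \<longleftrightarrow> ?R"
    by (intro all_cong1 imp_cong refl eventually_cong)
       (auto simp: eventually_at_filter q_le intro!: always_eventually)
  finally show ?thesis
    using True by (simp add: regular_subdiff_def q_def[abs_def])
qed

lemma regular_subdiff_subset_subdiff: "regular_subdiff f x \<subseteq> subdiff f x"
proof
  fix v
  assume v: "v \<in> regular_subdiff f x"
  then have "(\<lambda>_. x) \<longlonglongrightarrow> x \<and> (\<lambda>_. f x) \<longlonglongrightarrow> f x \<and> (\<lambda>_. v) \<longlonglongrightarrow> v \<and>
      (\<forall>t::nat. v \<in> regular_subdiff f x)"
    by simp
  then show "v \<in> subdiff f x"
    using v unfolding subdiff_def regular_subdiff_def by blast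
qed

text \<open>
  Adding \<open>h\<close> changes the first-order minorants by its linearization, up to an error that can
  be absorbed by splitting \<open>e\<close> into two halves.
\<close>

lemma regular_subdiff_add_smooth:
  fixes h P :: "'a::real_inner \<Rightarrow> ereal"
  assumes h: "\<And>z. h z \<noteq> -\<infinity>" and P: "\<And>z. P z \<noteq> -\<infinity>"
    and dom: "open (edom h)" "x \<in> edom h"
    and g: "GDERIV (\<lambda>y. real_of_ereal (h y)) x :> g"
  shows "v \<in> regular_subdiff (\<lambda>z. h z + P z) x \<longleftrightarrow> v - g \<in> regular_subdiff P x"
proof -
  let ?hr = "\<lambda>y. real_of_ereal (h y)"
  have hr: "h z = ereal (?hr z)" if "z \<in> edom h" for z
    using that h[of z] by (cases "h z") (auto simp: edom_def)
  obtain a where a: "h x = ereal a" using hr dom by blast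
  have near: "\<forall>\<^sub>F z in at x. \<exists>b. h z = ereal b \<and>
      a + g \<bullet> (z - x) - e * norm (z - x) \<le> b \<and> b \<le> a + g \<bullet> (z - x) + e * norm (z - x)"
    if e: "0 < e" for e
  proof -
    have "(?hr has_derivative (\<lambda>k. k \<bullet> g)) (at x)"
      using g by (simp add: gderiv_def)
    then obtain d where d: "d > 0"
      "\<And>z. norm (z - x) < d \<Longrightarrow> norm (?hr z - ?hr x - (z - x) \<bullet> g) \<le> e * norm (z - x)"
      using e unfolding has_derivative_at_alt by blast
    have "\<forall>\<^sub>F z in at x. \<bar>?hr z - a - g \<bullet> (z - x)\<bar> \<le> e * norm (z - x)"
      unfolding eventually_at using d a
      by (auto simp: dist_norm inner_commute intro!: exI[of _ d])
    moreover have "\<forall>\<^sub>F z in at x. z \<in> edom h"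
      using dom by (rule eventually_at_in_open')
    ultimately show ?thesis
    proof eventually_elim
      case (elim z)
      then show ?case by (intro exI[of _ "?hr z"] conjI hr) (auto simp: abs_le_iff)
    qed
  qed
  have edom: "x \<in> edom (\<lambda>z. h z + P z) \<longleftrightarrow> x \<in> edom P"
    using hr[OF dom(2)] P[of x] by (cases "P x") (auto simp: edom_def)
  have fin: "h z + P z \<noteq> -\<infinity>" for z
    using h P by simp
  show ?thesis
    unfolding regular_subdiff_iff[of "\<lambda>z. h z + P z", OF fin] regular_subdiff_iff[OF P] edom
  proof (intro conj_cong refl)
    assume "x \<in> edom P"
    then obtain p where p: "P x = ereal p"
      using P[of x] by (cases "P x") (auto simp: edom_def)
    show "(\<forall>e>0. \<forall>\<^sub>F z in at x. h x + P x + ereal (v \<bullet> (z - x) - e * norm (z - x)) \<le> h z + P z)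
      \<longleftrightarrow> (\<forall>e>0. \<forall>\<^sub>F z in at x. P x + ereal ((v - g) \<bullet> (z - x) - e * norm (z - x)) \<le> P z)"
      (is "(\<forall>e>0. ?F e) \<longleftrightarrow> (\<forall>e>0. ?P e)")
    proof (intro iffI allI impI)
      fix e :: real
      assume A: "\<forall>e>0. ?F e" and e: "0 < e"
      have e2: "0 < e / 2" using e by simp
      from A e2 have "?F (e / 2)" by blast
      then show "?P e"
        using near[OF e2]
      proof eventually_elim
        case (elim z)
        then show ?case
          using a p P[of z] by (cases "P z") (auto simp: inner_diff_left)
      qed
    next
      fix e :: real
      assume A: "\<forall>e>0. ?P e" and e: "0 < e"
      have e2: "0 < e / 2" using e by simp
      from A e2 have "?P (e / 2)" by blast
      then show "?F e"
        using near[OF e2]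
      proof eventually_elim
        case (elim z)
        then show ?case
          using a p P[of z] by (cases "P z") (auto simp: inner_diff_left)
      qed
    qed
  qed
qed

text \<open>
  A local first-order minorant of a convex function is global: evaluate it at \<open>x + t (y - x)\<close>,
  bound the function there by the chord, and divide by \<open>t\<close>. The error term becomes
  \<open>e * norm (y - x)\<close> and disappears as \<open>e\<close> tends to \<open>0\<close>.
\<close>

lemma convex_regular_subdiff_iff:
  fixes P :: "'a::real_inner \<Rightarrow> ereal"
  assumes "\<And>z. P z \<noteq> -\<infinity>" and cvx: "convex_fun P"
  shows "g \<in> regular_subdiff P x \<longleftrightarrow>
    x \<in> edom P \<and> (\<forall>y. P x + ereal (g \<bullet> (y - x)) \<le> P y)"
proof (intro iffI conjI allI)
  assume g: "g \<in> regular_subdiff P x"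
  then show x: "x \<in> edom P" by (simp add: regular_subdiff_def)
  fix y
  obtain p where p: "P x = ereal p"
    using x assms(1)[of x] by (cases "P x") (auto simp: edom_def)
  show "P x + ereal (g \<bullet> (y - x)) \<le> P y"
  proof (cases "P y")
    case (real s)
    have "p + g \<bullet> (y - x) \<le> s"
    proof (cases "y = x")
      case True
      then show ?thesis using real p by simp
    next
      case False
      have approx: "p + g \<bullet> (y - x) \<le> s + e * norm (y - x)" if "0 < e" for e
      proof -
        have "((\<lambda>t. x + t *\<^sub>R (y - x)) \<longlongrightarrow> x + 0 *\<^sub>R (y - x)) (at_right (0::real))"
          by (intro tendsto_intros)
        moreover have "\<forall>\<^sub>F t in at_right (0::real). x + t *\<^sub>R (y - x) \<noteq> x"
          using False by (auto simp: eventually_at_filter)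
        ultimately have lim: "filterlim (\<lambda>t. x + t *\<^sub>R (y - x)) (at x) (at_right (0::real))"
          by (simp add: filterlim_at)
        have "\<forall>\<^sub>F z in at x. P x + ereal (g \<bullet> (z - x) - e * norm (z - x)) \<le> P z"
          using g that unfolding regular_subdiff_iff[OF assms(1)] by blast
        then have "\<forall>\<^sub>F t in at_right (0::real).
            P x + ereal (g \<bullet> (t *\<^sub>R (y - x)) - e * norm (t *\<^sub>R (y - x))) \<le> P (x + t *\<^sub>R (y - x))"
          using lim by (auto simp: filterlim_iff)
        moreover have "\<forall>\<^sub>F t in at_right (0::real). 0 < t \<and> t < 1"
          unfolding eventually_at_right_field by (intro exI[of _ 1]) auto
        ultimately have "\<forall>\<^sub>F t in at_right (0::real). p + g \<bullet> (y - x) \<le> s + e * norm (y - x)"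
        proof eventually_elim
          case (elim t)
          have "(1 - t) *\<^sub>R x + t *\<^sub>R y = x + t *\<^sub>R (y - x)"
            by (simp add: algebra_simps)
          then have "P (x + t *\<^sub>R (y - x)) \<le> ereal (1 - t) * P x + ereal t * P y"
            using cvx elim(2) unfolding convex_fun_def by metis
          with elim(1) have "p + (g \<bullet> (t *\<^sub>R (y - x)) - e * norm (t *\<^sub>R (y - x))) \<le> (1 - t) * p + t * s"
            using p real by (cases "P (x + t *\<^sub>R (y - x))") auto
          then have "p + t * (g \<bullet> (y - x)) - t * (e * norm (y - x)) \<le> (1 - t) * p + t * s"
            using elim(2) by (simp only: inner_scaleR_right norm_scaleR) (simp add: mult.left_commute)
          then have "t * (p + g \<bullet> (y - x)) \<le> t * (s + e * norm (y - x))"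
            by (simp only: ring_distribs)
          then show ?case
            using elim(2) by simp
        qed
        then show ?thesis
          using eventually_happens' trivial_limit_at_right_real by blast
      qed
      show ?thesis
      proof (rule field_le_epsilon)
        fix d :: real
        assume "0 < d"
        then show "p + g \<bullet> (y - x) \<le> s + d"
          using approx[of "d / norm (y - x)"] False by simp
      qed
    qed
    then show ?thesis using real p by simp
  qed (use assms(1) in auto)
next
  assume *: "x \<in> edom P \<and> (\<forall>y. P x + ereal (g \<bullet> (y - x)) \<le> P y)"
  have "P x + ereal (g \<bullet> (z - x) - e * norm (z - x)) \<le> P z" if "0 < e" for e z
  proof -
    have "P x + ereal (g \<bullet> (z - x) - e * norm (z - x)) \<le> P x + ereal (g \<bullet> (z - x))"
      using that by (intro add_left_mono) simp
    with * show ?thesis by (meson order_trans)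
  qed
  then show "g \<in> regular_subdiff P x"
    unfolding regular_subdiff_iff[OF assms(1)] using * by simp
qed

section \<open>Limiting subgradients of a smooth plus a convex function\<close>

text \<open>
  Each subgradient inequality, with the test point \<open>y\<close> held fixed, bounds \<open>P (xs k)\<close> from above by a
  convergent sequence; lower semicontinuity carries this bound to the limit.
\<close>

lemma convex_regular_subdiff_closed:
  fixes P :: "'a::real_inner \<Rightarrow> ereal"
  assumes P: "\<And>z. P z \<noteq> -\<infinity>" "convex_fun P" "closed_fun P"
    and lim: "xs \<longlonglongrightarrow> x" "gs \<longlonglongrightarrow> g"
    and gs: "\<And>k::nat. gs k \<in> regular_subdiff P (xs k)"
    and x: "x \<in> edom P"
  shows "g \<in> regular_subdiff P x"
  unfolding convex_regular_subdiff_iff[OF P(1,2)]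
proof (intro conjI allI x)
  fix y
  show "P x + ereal (g \<bullet> (y - x)) \<le> P y"
  proof (cases "P y")
    case (real s)
    have "P (xs k) \<le> ereal (s - gs k \<bullet> (y - xs k))" for k
    proof -
      have "P (xs k) + ereal (gs k \<bullet> (y - xs k)) \<le> ereal s"
        using gs real unfolding convex_regular_subdiff_iff[OF P(1,2)] by metis
      then show ?thesis
        using P(1)[of "xs k"] by (cases "P (xs k)") auto
    qed
    moreover have "(\<lambda>k. ereal (s - gs k \<bullet> (y - xs k))) \<longlonglongrightarrow> ereal (s - g \<bullet> (y - x))"
      by (intro tendsto_intros lim)
    ultimately have "P x \<le> ereal (s - g \<bullet> (y - x))"
      using closed_fun_limit_le[OF P(3) lim(1)] by blast
    then show ?thesis
      using real P(1)[of x] by (cases "P x") auto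
  qed (use P(1) in auto)
qed

lemma gderiv_grad:
  assumes "smooth_on_dom h" "x \<in> edom h"
  shows "GDERIV (\<lambda>y. real_of_ereal (h y)) x :> grad h x"
proof -
  obtain g where g: "GDERIV (\<lambda>y. real_of_ereal (h y)) x :> g"
    using assms unfolding smooth_on_dom_def by blast
  have "g' = g" if g': "GDERIV (\<lambda>y. real_of_ereal (h y)) x :> g'" for g'
  proof -
    have "(\<lambda>k. k \<bullet> g') = (\<lambda>k. k \<bullet> g)"
      using g g' unfolding gderiv_def by (rule has_derivative_unique[rotated])
    then show ?thesis
      by (metis inner_commute inner_eq_zero_iff inner_diff_right eq_iff_diff_eq_0)
  qed
  then show ?thesis
    unfolding grad_def using g by (metis theI)
qed

lemma isCont_grad:
  assumes "smooth_on_dom h" "open (edom h)" "x \<in> edom h"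
  shows "isCont (grad h) x"
  using assms by (simp add: smooth_on_dom_def continuous_on_eq_continuous_at)

lemma edom_add:
  fixes h P :: "'a \<Rightarrow> ereal"
  assumes "\<And>z. h z \<noteq> -\<infinity>" "\<And>z. P z \<noteq> -\<infinity>"
  shows "edom (\<lambda>z. h z + P z) = edom h \<inter> edom P"
proof -
  have "h z + P z < \<infinity> \<longleftrightarrow> h z < \<infinity> \<and> P z < \<infinity>" for z
    using assms[of z] by (cases "h z"; cases "P z") auto
  then show ?thesis by (auto simp: edom_def)
qed

text \<open>
  Subtracting the gradients, which converge by continuity, reduces closedness for the sum to
  closedness for the convex part.
\<close>

lemma subdiff_add_smooth_convex_closed:
  fixes h P :: "'a::real_inner \<Rightarrow> ereal"
  assumes h: "\<And>z. h z \<noteq> -\<infinity>" "open (edom h)" "smooth_on_dom h"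
    and P: "\<And>z. P z \<noteq> -\<infinity>" "convex_fun P" "closed_fun P"
    and lim: "xs \<longlonglongrightarrow> x" "vs \<longlonglongrightarrow> v"
    and vs: "\<And>k::nat. vs k \<in> regular_subdiff (\<lambda>z. h z + P z) (xs k)"
    and x: "x \<in> edom (\<lambda>z. h z + P z)"
  shows "v \<in> regular_subdiff (\<lambda>z. h z + P z) x"
proof -
  note edom = edom_add[of h P, OF h(1) P(1)]
  have xs: "xs k \<in> edom h" for k
    using vs[of k] edom by (auto simp: regular_subdiff_def)
  have xh: "x \<in> edom h" and xP: "x \<in> edom P" using x edom by auto
  have "(\<lambda>k. grad h (xs k)) \<longlonglongrightarrow> grad h x"
    using isCont_grad[OF h(3,2) xh] lim(1) by (rule isCont_tendsto_compose)
  then have "(\<lambda>k. vs k - grad h (xs k)) \<longlonglongrightarrow> v - grad h x"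
    by (intro tendsto_diff lim)
  moreover have "vs k - grad h (xs k) \<in> regular_subdiff P (xs k)" for k
    using vs regular_subdiff_add_smooth[where h=h and P=P, OF h(1) P(1) h(2) xs gderiv_grad[OF h(3) xs]]
    by blast
  ultimately have "v - grad h x \<in> regular_subdiff P x"
    using convex_regular_subdiff_closed[OF P lim(1)] xP by blast
  then show ?thesis
    using regular_subdiff_add_smooth[where h=h and P=P, OF h(1) P(1) h(2) xh gderiv_grad[OF h(3) xh]]
    by blast
qed

lemma subdiff_add_smooth_convex:
  fixes h P :: "'a::real_inner \<Rightarrow> ereal"
  assumes h: "\<And>z. h z \<noteq> -\<infinity>" "open (edom h)" "smooth_on_dom h"
    and P: "\<And>z. P z \<noteq> -\<infinity>" "convex_fun P" "closed_fun P"
  shows "subdiff (\<lambda>z. h z + P z) x = regular_subdiff (\<lambda>z. h z + P z) x"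
proof
  show "subdiff (\<lambda>z. h z + P z) x \<subseteq> regular_subdiff (\<lambda>z. h z + P z) x"
    using subdiff_add_smooth_convex_closed[where h=h and P=P, OF h P]
    unfolding subdiff_def by blast
qed (rule regular_subdiff_subset_subdiff)

section \<open>The proximal residual\<close>

text \<open>
  The definition of \<open>prox\<close> chooses a minimizer, so existence has to be shown. A subgradient \<open>g\<close> of \<open>P\<close>
  at any one point supplies an affine minorant; added to the quadratic and completed to a square, it
  is a quadratic minorant centred at \<open>w - g\<close>. Minimizing sequences are thus bounded, and a limit of
  a subsequence is a minimizer by lower semicontinuity.
\<close>

lemma prox_minimizes:
  fixes P :: "'a::euclidean_space \<Rightarrow> ereal"
  assumes P: "\<And>z. P z \<noteq> -\<infinity>" "convex_fun P" "closed_fun P"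
    and g: "g \<in> regular_subdiff P x"
  shows "P (prox P w) + ereal (1/2 * (norm (prox P w - w))\<^sup>2)
    \<le> P u + ereal (1/2 * (norm (u - w))\<^sup>2)"
proof -
  define \<phi> where "\<phi> u = P u + ereal (1/2 * (norm (u - w))\<^sup>2)" for u
  obtain p where p: "P x = ereal p"
    using g P(1)[of x] by (cases "P x") (auto simp: regular_subdiff_def edom_def)
  \<comment> \<open>The constant left over when the affine minorant plus the quadratic is completed to a square.\<close>
  define K where "K = p + g \<bullet> (w - x) - 1/2 * (norm g)\<^sup>2"
  have lower: "ereal (K + 1/2 * (norm (u - (w - g)))\<^sup>2) \<le> \<phi> u" for u
  proof -
    have "ereal (p + g \<bullet> (u - x)) \<le> P u"
      using g p unfolding convex_regular_subdiff_iff[OF P(1,2)] by (metis plus_ereal.simps(1))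
    moreover have "K + 1/2 * (norm (u - (w - g)))\<^sup>2
        = p + g \<bullet> (u - x) + 1/2 * (norm (u - w))\<^sup>2"
      by (simp add: K_def power2_norm_eq_inner algebra_simps inner_commute)
    ultimately show ?thesis
      unfolding \<phi>_def by (metis add_right_mono plus_ereal.simps(1))
  qed
  obtain us where us: "(\<lambda>k. \<phi> (us k)) \<longlonglongrightarrow> (INF u. \<phi> u)"
  proof -
    obtain a where a: "\<And>n. a n \<in> range \<phi>" "a \<longlonglongrightarrow> Inf (range \<phi>)"
      using Inf_as_limit[of "range \<phi>"] by auto
    have "\<forall>n. \<exists>b. a n = \<phi> b" using a(1) by blast
    then obtain b where "\<forall>n. a n = \<phi> (b n)" by (rule choice[THEN exE])
    then have "a = (\<lambda>n. \<phi> (b n))" by auto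
    with a(2) show ?thesis using that by simp
  qed
  define m where "m = (INF u. \<phi> u)"
  have "m \<le> \<phi> x" unfolding m_def by (rule INF_lower) simp
  then have "m < \<infinity>" using p by (auto simp: \<phi>_def)
  have "ereal K \<le> m"
    unfolding m_def
  proof (rule INF_greatest)
    fix u
    have "ereal K \<le> ereal (K + 1/2 * (norm (u - (w - g)))\<^sup>2)" by simp
    then show "ereal K \<le> \<phi> u" using lower order_trans by blast
  qed
  with \<open>m < \<infinity>\<close> obtain mr where mr: "m = ereal mr" by (cases m) auto
  have "\<forall>\<^sub>F k in sequentially. \<phi> (us k) < ereal (mr + 1)"
    using us mr unfolding m_def[symmetric] by (auto intro: order_tendstoD)
  then obtain N where N: "\<And>k. k \<ge> N \<Longrightarrow> \<phi> (us k) < ereal (mr + 1)"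
    by (auto simp: eventually_sequentially)
  have "bounded (range (\<lambda>k. us (k + N)))"
  proof -
    have "norm (us (k + N) - (w - g)) \<le> sqrt (2 * (mr + 1 - K))" for k
    proof (rule real_le_rsqrt)
      have "ereal (K + 1/2 * (norm (us (k + N) - (w - g)))\<^sup>2) < ereal (mr + 1)"
        using lower N le_less_trans le_add2 by blast
      then show "(norm (us (k + N) - (w - g)))\<^sup>2 \<le> 2 * (mr + 1 - K)" by simp
    qed
    then show ?thesis
      unfolding bounded_def by (intro exI[of _ "w - g"]) (auto simp: dist_norm norm_minus_commute)
  qed
  then obtain l r where l: "strict_mono r" "((\<lambda>k. us (k + N)) \<circ> r) \<longlonglongrightarrow> l"
    using bounded_imp_convergent_subsequence by blast
  define ws where "ws k = us (r k + N)" for k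
  have ws: "ws \<longlonglongrightarrow> l" using l(2) by (simp add: ws_def[abs_def] o_def)
  have "(\<lambda>k. \<phi> (us (k + N))) \<longlonglongrightarrow> ereal mr"
    using LIMSEQ_ignore_initial_segment[OF us, of N] mr unfolding m_def[symmetric] by simp
  from LIMSEQ_subseq_LIMSEQ[OF this l(1)] have \<phi>ws: "(\<lambda>k. \<phi> (ws k)) \<longlonglongrightarrow> ereal mr"
    by (simp add: ws_def o_def)
  have "(\<lambda>k. ereal (- (1/2 * (norm (ws k - w))\<^sup>2))) \<longlonglongrightarrow> ereal (- (1/2 * (norm (l - w))\<^sup>2))"
    by (intro tendsto_intros ws)
  from tendsto_add_ereal[OF _ _ \<phi>ws this]
  have "(\<lambda>k. \<phi> (ws k) + ereal (- (1/2 * (norm (ws k - w))\<^sup>2)))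
      \<longlonglongrightarrow> ereal (mr + - (1/2 * (norm (l - w))\<^sup>2))"
    by simp
  moreover have "P (ws k) \<le> \<phi> (ws k) + ereal (- (1/2 * (norm (ws k - w))\<^sup>2))" for k
    unfolding \<phi>_def by (cases "P (ws k)") auto
  ultimately have "P l \<le> ereal (mr + - (1/2 * (norm (l - w))\<^sup>2))"
    using closed_fun_limit_le[OF P(3) ws] by blast
  then have "\<phi> l \<le> m"
    unfolding \<phi>_def mr by (cases "P l") auto
  then have "\<phi> l \<le> \<phi> u" for u
    unfolding m_def by (meson INF_lower UNIV_I order_trans)
  then have "is_arg_min \<phi> (\<lambda>_. True) l"
    by (simp add: is_arg_min_def not_less)
  then have "is_arg_min \<phi> (\<lambda>_. True) (arg_min \<phi> (\<lambda>_. True))"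
    unfolding arg_min_def by (rule someI)
  moreover have "prox P w = arg_min \<phi> (\<lambda>_. True)"
    by (simp only: prox_def \<phi>_def[abs_def])
  ultimately have "\<phi> (prox P w) \<le> \<phi> u"
    by (simp add: is_arg_min_def not_less)
  then show ?thesis unfolding \<phi>_def .
qed

text \<open>
  Expanding the squares in the minimality of \<open>y = prox P w\<close> gives
  \<open>P y + (w - y) \<bullet> (u - y) - (norm (u - y))\<^sup>2 / 2 \<le> P u\<close>, and the quadratic term is of smaller than
  first order near \<open>y\<close>.
\<close>

lemma prox_subgradient:
  fixes P :: "'a::euclidean_space \<Rightarrow> ereal"
  assumes P: "\<And>z. P z \<noteq> -\<infinity>" "convex_fun P" "closed_fun P"
    and g: "g \<in> regular_subdiff P x"
  shows "w - prox P w \<in> regular_subdiff P (prox P w)"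
proof -
  define y where "y = prox P w"
  have min: "P y + ereal (1/2 * (norm (y - w))\<^sup>2) \<le> P u + ereal (1/2 * (norm (u - w))\<^sup>2)" for u
    unfolding y_def by (rule prox_minimizes[OF P g])
  have y: "y \<in> edom P"
    using min[of x] g by (auto simp: regular_subdiff_def edom_def)
  then obtain s where s: "P y = ereal s"
    using P(1)[of y] by (cases "P y") (auto simp: edom_def)
  have "\<forall>\<^sub>F u in at y. P y + ereal ((w - y) \<bullet> (u - y) - e * norm (u - y)) \<le> P u"
    if "0 < e" for e
  proof -
    have "P y + ereal ((w - y) \<bullet> (u - y) - e * norm (u - y)) \<le> P u" if "dist u y < 2 * e" for u
    proof -
      have "1/2 * (norm (u - w))\<^sup>2 - 1/2 * (norm (y - w))\<^sup>2
          = 1/2 * (norm (u - y))\<^sup>2 - (w - y) \<bullet> (u - y)"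
        by (simp add: power2_norm_eq_inner algebra_simps inner_commute)
      moreover have "1/2 * (norm (u - y))\<^sup>2 \<le> e * norm (u - y)"
        using mult_right_mono[of "norm (u - y)" "2 * e" "norm (u - y)"] that
        by (simp add: power2_eq_square dist_norm)
      ultimately show ?thesis
        using min[of u] s by (cases "P u") auto
    qed
    then show ?thesis
      unfolding eventually_at using that by (intro exI[of _ "2 * e"]) auto
  qed
  then show ?thesis
    using y unfolding regular_subdiff_iff[OF P(1)] y_def by blast
qed

text \<open>
  This is nonexpansiveness of the proximal mapping, compared at the arguments \<open>x - a\<close> and
  \<open>x - a + v\<close>, the second of which it maps to \<open>x\<close>. Adding the subgradient inequalities at \<open>x\<close> and at
  \<open>y = prox P (x - a)\<close> gives \<open>(norm (y - x))\<^sup>2 \<le> - (v \<bullet> (y - x))\<close>.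
\<close>

lemma prox_residual_le:
  fixes P :: "'a::euclidean_space \<Rightarrow> ereal"
  assumes P: "\<And>z. P z \<noteq> -\<infinity>" "convex_fun P" "closed_fun P"
    and v: "v - a \<in> regular_subdiff P x"
  shows "norm (prox P (x - a) - x) \<le> norm v"
proof -
  define y where "y = prox P (x - a)"
  have y: "x - a - y \<in> regular_subdiff P y"
    unfolding y_def by (rule prox_subgradient[OF P v])
  note sub = convex_regular_subdiff_iff[OF P(1,2)]
  obtain p where p: "P x = ereal p"
    using v P(1)[of x] by (cases "P x") (auto simp: regular_subdiff_def edom_def)
  obtain s where s: "P y = ereal s"
    using y P(1)[of y] by (cases "P y") (auto simp: regular_subdiff_def edom_def)
  have "p + (v - a) \<bullet> (y - x) \<le> s" "s + (x - a - y) \<bullet> (x - y) \<le> p"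
    using v y p s unfolding sub by (metis ereal_less_eq(3) plus_ereal.simps(1))+
  then have "(norm (y - x))\<^sup>2 \<le> - (v \<bullet> (y - x))"
    by (simp add: power2_norm_eq_inner algebra_simps inner_commute)
  also have "\<dots> \<le> norm v * norm (y - x)"
    using norm_cauchy_schwarz[of v "x - y"] by (simp add: inner_diff_right norm_minus_commute)
  finally have "norm (y - x) * norm (y - x) \<le> norm v * norm (y - x)"
    by (simp add: power2_eq_square)
  then show ?thesis
    unfolding y_def[symmetric] by (cases "norm (y - x) = 0") (auto simp: mult_le_cancel_right)
qed

section \<open>Growth of the function near a stationary point\<close>

text \<open>
  By the mean value theorem the increment is \<open>G w \<bullet> (x - z)\<close> for some \<open>w\<close> on the segment, and
  \<open>G w\<close> differs from \<open>G x\<close> by at most \<open>L * norm (x - z)\<close>. The constant is twice the sharp one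
  obtained by integration. The gradient is taken at \<open>x\<close> so that it cancels
  against the one in a subgradient of the sum at \<open>x\<close>.
\<close>

lemma lipschitz_gradient_upper_bound:
  fixes \<phi> :: "'a::euclidean_space \<Rightarrow> real"
  assumes deriv: "\<And>w. w \<in> S \<Longrightarrow> GDERIV \<phi> w :> G w"
    and lip: "L-lipschitz_on S G"
    and S: "convex S" "x \<in> S" "z \<in> S"
  shows "\<phi> x - \<phi> z \<le> G x \<bullet> (x - z) + L * (norm (x - z))\<^sup>2"
proof (cases "x = z")
  case True
  then show ?thesis by simp
next
  case False
  have seg: "closed_segment z x \<subseteq> S"
    using S by (simp add: closed_segment_subset)
  define \<psi> where "\<psi> t = \<phi> (z + t *\<^sub>R (x - z))" for t
  have inS: "z + t *\<^sub>R (x - z) \<in> S" if "0 \<le> t" "t \<le> 1" for t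
    using seg that by (force simp: closed_segment_def algebra_simps)
  have der: "(\<psi> has_derivative (\<lambda>k. (k *\<^sub>R (x - z)) \<bullet> G (z + t *\<^sub>R (x - z)))) (at t)"
    if "0 \<le> t" "t \<le> 1" for t
  proof -
    have "((\<lambda>t. z + t *\<^sub>R (x - z)) has_derivative (\<lambda>k. k *\<^sub>R (x - z))) (at t)"
      by (auto intro!: derivative_eq_intros)
    from has_derivative_compose[OF this] deriv[OF inS[OF that]]
    show ?thesis unfolding \<psi>_def gderiv_def by blast
  qed
  obtain t where t: "0 < t" "t < 1"
    and mvt: "\<psi> 1 - \<psi> 0 = ((1 - 0) *\<^sub>R (x - z)) \<bullet> G (z + t *\<^sub>R (x - z))"
    using mvt_simple[of 0 1 \<psi> "\<lambda>t k. (k *\<^sub>R (x - z)) \<bullet> G (z + t *\<^sub>R (x - z))"]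
      der has_derivative_at_withinI by force
  define w where "w = z + t *\<^sub>R (x - z)"
  have w: "w \<in> S" using inS t by (simp add: w_def)
  have "norm (G w - G x) \<le> L * norm (w - x)"
    using lipschitz_onD[OF lip w S(2)] by (simp add: dist_norm)
  also have "w - x = (1 - t) *\<^sub>R (z - x)"
    by (simp add: w_def algebra_simps)
  also have "L * norm ((1 - t) *\<^sub>R (z - x)) \<le> L * norm (x - z)"
    using t lipschitz_on_nonneg[OF lip]
    by (intro mult_left_mono) (auto simp: norm_minus_commute mult_left_le_one_le)
  finally have G: "norm (G w - G x) \<le> L * norm (x - z)" .
  have "\<phi> x - \<phi> z = (x - z) \<bullet> G w"
    using mvt by (simp add: \<psi>_def w_def)
  also have "\<dots> = G x \<bullet> (x - z) + (G w - G x) \<bullet> (x - z)"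
    by (simp add: inner_diff_left inner_diff_right inner_commute)
  also have "(G w - G x) \<bullet> (x - z) \<le> L * norm (x - z) * norm (x - z)"
    using norm_cauchy_schwarz[of "G w - G x" "x - z"] G
    by (meson mult_right_mono norm_ge_zero order_trans)
  finally show ?thesis by (simp add: power2_eq_square)
qed

text \<open>
  The subgradient inequality of \<open>P\<close> at \<open>x\<close> contributes \<open>(v - grad h x) \<bullet> (x - z)\<close> and the bound for \<open>h\<close>
  contributes \<open>grad h x \<bullet> (x - z)\<close>. The gradients cancel, leaving only \<open>v\<close> and the quadratic error.
\<close>

lemma smooth_convex_gap_le:
  fixes h P :: "'a::euclidean_space \<Rightarrow> ereal"
  assumes h: "\<And>z. h z \<noteq> -\<infinity>" "open (edom h)" "smooth_on_dom h"
    and P: "\<And>z. P z \<noteq> -\<infinity>" "convex_fun P"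
    and S: "convex S" "S \<subseteq> edom h" "L-lipschitz_on S (grad h)" "x \<in> S" "z \<in> S"
    and v: "v \<in> regular_subdiff (\<lambda>z. h z + P z) x"
  shows "h x + P x \<le> h z + P z + ereal (norm v * norm (x - z) + L * (norm (x - z))\<^sup>2)"
proof -
  have dom: "x \<in> edom h" "z \<in> edom h" using S by auto
  have sub: "v - grad h x \<in> regular_subdiff P x"
    using v regular_subdiff_add_smooth[where h=h and P=P, OF h(1) P(1) h(2) dom(1) gderiv_grad[OF h(3) dom(1)]]
    by blast
  obtain a where a: "h x = ereal a"
    using dom(1) h(1)[of x] by (cases "h x") (auto simp: edom_def)
  obtain b where b: "h z = ereal b"
    using dom(2) h(1)[of z] by (cases "h z") (auto simp: edom_def)
  obtain p where p: "P x = ereal p"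
    using sub P(1)[of x] by (cases "P x") (auto simp: regular_subdiff_def edom_def)
  have conv: "P x + ereal ((v - grad h x) \<bullet> (z - x)) \<le> P z"
    using sub unfolding convex_regular_subdiff_iff[OF P] by blast
  have smooth: "a - b \<le> grad h x \<bullet> (x - z) + L * (norm (x - z))\<^sup>2"
    using lipschitz_gradient_upper_bound[where \<phi>="\<lambda>y. real_of_ereal (h y)" and G="grad h", OF _ S(3,1,4,5)]
      gderiv_grad[OF h(3)] S(2) a b by auto
  have "v \<bullet> (x - z) \<le> norm v * norm (x - z)" by (rule norm_cauchy_schwarz)
  then show ?thesis
    using conv smooth a b p by (cases "P z") (auto simp: algebra_simps)
qed

section \<open>The Kurdyka-Lojasiewicz inequality\<close>

lemma KL_property_atI:
  assumes "0 < c" "0 < \<epsilon>" "0 < \<nu>"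
    and "\<And>x v. norm (x - xbar) \<le> \<epsilon> \<Longrightarrow> f xbar < f x \<Longrightarrow> f x < f xbar + \<nu> \<Longrightarrow> v \<in> subdiff f x
      \<Longrightarrow> c * real_of_ereal (f x - f xbar) powr \<alpha> \<le> norm v"
  shows "KL_property_at f \<alpha> xbar"
  unfolding KL_property_at_def einfdist_def
  using assms by (intro exI[of _ c] exI[of _ \<epsilon>] exI[of _ \<nu>] conjI) (auto intro!: INF_greatest)

lemma real_gap_bounds:
  fixes a b :: ereal
  assumes "a \<noteq> -\<infinity>" "a < b" "b < a + 1"
  shows "0 < real_of_ereal (b - a)" "real_of_ereal (b - a) < 1"
proof -
  show "0 < real_of_ereal (b - a)"
    using assms by (cases a; cases b) auto
  show "real_of_ereal (b - a) < 1"
    using assms by (cases a; cases b) (auto simp: one_ereal_def)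
qed

text \<open>
  If the graph of the subdifferential is closed at \<open>xbar\<close>, then a vanishing sequence of subgradients at
  points tending to \<open>xbar\<close> would make \<open>xbar\<close> stationary. Subgradients nearby are thus bounded away from
  \<open>0\<close>, while powers of gaps below \<open>1\<close> are at most \<open>1\<close>.
\<close>

lemma KL_property_at_nonstationary:
  fixes f :: "'a::real_inner \<Rightarrow> ereal"
  assumes closed: "\<And>xs vs v. xs \<longlonglongrightarrow> xbar \<Longrightarrow> vs \<longlonglongrightarrow> v \<Longrightarrow>
      (\<And>k::nat. vs k \<in> subdiff f (xs k)) \<Longrightarrow> v \<in> subdiff f xbar"
    and "0 \<notin> subdiff f xbar" "f xbar \<noteq> -\<infinity>" "0 \<le> \<alpha>"
  shows "KL_property_at f \<alpha> xbar"
proof -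
  have "\<exists>\<eta>>0. \<forall>x v. norm (x - xbar) \<le> \<eta> \<longrightarrow> v \<in> subdiff f x \<longrightarrow> \<eta> \<le> norm v"
  proof (rule ccontr)
    assume no: "\<not> ?thesis"
    have "\<exists>x v. norm (x - xbar) \<le> inverse (real (Suc k)) \<and> v \<in> subdiff f x
        \<and> norm v \<le> inverse (real (Suc k))" for k
    proof -
      have "0 < inverse (real (Suc k))" by simp
      with no show ?thesis by (meson le_cases)
    qed
    then obtain xs vs where
      xs: "\<And>k. norm (xs k - xbar) \<le> inverse (real (Suc k))"
      and sub: "\<And>k. vs k \<in> subdiff f (xs k)"
      and vs: "\<And>k. norm (vs k) \<le> inverse (real (Suc k))"
      by metis
    have "(\<lambda>k. xs k - xbar) \<longlonglongrightarrow> 0" "vs \<longlonglongrightarrow> 0"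
      using xs vs by (auto intro!: Lim_null_comparison[OF _ LIMSEQ_inverse_real_of_nat])
    then have "0 \<in> subdiff f xbar"
      using closed sub by (simp add: LIM_zero_iff)
    with assms(2) show False by blast
  qed
  then obtain \<eta> where \<eta>: "0 < \<eta>"
    "\<And>x v. norm (x - xbar) \<le> \<eta> \<Longrightarrow> v \<in> subdiff f x \<Longrightarrow> \<eta> \<le> norm v" by blast
  show ?thesis
  proof (rule KL_property_atI[of \<eta> \<eta> 1])
    fix x v
    assume x: "norm (x - xbar) \<le> \<eta>" "f xbar < f x" "f x < f xbar + 1" and v: "v \<in> subdiff f x"
    note d = real_gap_bounds[OF assms(3) x(2,3)]
    have "real_of_ereal (f x - f xbar) powr \<alpha> \<le> 1"
      using d \<open>0 \<le> \<alpha>\<close> powr_mono2[of \<alpha> "real_of_ereal (f x - f xbar)" 1] by simp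
    then have "\<eta> * real_of_ereal (f x - f xbar) powr \<alpha> \<le> \<eta> * 1"
      using \<eta>(1) by (intro mult_left_mono) auto
    with \<eta>(2)[OF x(1) v] show "\<eta> * real_of_ereal (f x - f xbar) powr \<alpha> \<le> norm v" by simp
  qed (use \<eta> in auto)
qed

text \<open>
  The error bound is used at the level \<open>f xbar + 1\<close>, which is consistent with restricting to gaps
  below \<open>1\<close>. Its conclusion is a distance; doubling the constant makes the inequality strict, so that
  some stationary point \<open>z\<close> satisfies it.
\<close>

lemma KL_property_at_stationary:
  fixes h P :: "'a::euclidean_space \<Rightarrow> ereal"
  defines "f \<equiv> \<lambda>x. h x + P x"
  assumes h: "\<And>z. h z \<noteq> -\<infinity>" "open (edom h)" "smooth_on_dom h"
    and P: "\<And>z. P z \<noteq> -\<infinity>" "convex_fun P" "closed_fun P"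
    and stat: "xbar \<in> stationary_points f"
    and sep: "\<exists>\<delta>>0. \<forall>y. y \<in> stationary_points f \<and> norm (y - xbar) \<le> \<delta> \<longrightarrow> f y = f xbar"
    and LT: "luo_tseng_error_bound h P"
  shows "KL_property_at f (1/2) xbar"
proof -
  let ?X = "stationary_points f"
  have subdiff: "subdiff f x = regular_subdiff f x" for x
    unfolding f_def by (rule subdiff_add_smooth_convex[OF h P])
  have edom: "edom f = edom h \<inter> edom P"
    unfolding f_def by (rule edom_add[OF h(1) P(1)])
  have fmin: "f z \<noteq> -\<infinity>" for z
    using h(1) P(1) by (simp add: f_def)
  have xbar: "xbar \<in> edom f"
    using stat by (simp add: stationary_points_def subdiff regular_subdiff_def)
  then obtain fb where fb: "f xbar = ereal fb"
    using fmin[of xbar] by (cases "f xbar") (auto simp: edom_def)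
  have "(INF x. h x + P x) \<le> ereal (fb + 1)"
    by (rule INF_lower2[of xbar]) (use fb in \<open>auto simp: f_def\<close>)
  then obtain c e where ce: "0 < c" "0 < e"
    and bound: "\<And>x. norm (prox P (x - grad h x) - x) < e \<Longrightarrow> f x \<le> ereal (fb + 1) \<Longrightarrow>
      infdist x ?X \<le> c * norm (prox P (x - grad h x) - x)"
    using LT unfolding luo_tseng_error_bound_def f_def by blast
  have xh: "xbar \<in> edom h" using xbar edom by blast
  obtain \<delta>1 L where \<delta>1: "0 < \<delta>1" and lip: "L-lipschitz_on (ball xbar \<delta>1 \<inter> edom h) (grad h)"
    using h(3) xh unfolding smooth_on_dom_def by blast
  obtain \<delta>2 where \<delta>2: "0 < \<delta>2" "ball xbar \<delta>2 \<subseteq> edom h"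
    using h(2) xh open_contains_ball by blast
  obtain \<delta>3 where \<delta>3: "0 < \<delta>3" "\<And>y. y \<in> ?X \<Longrightarrow> norm (y - xbar) \<le> \<delta>3 \<Longrightarrow> f y = f xbar"
    using sep by blast
  define r where "r = min \<delta>1 (min \<delta>2 \<delta>3)"
  have r: "0 < r" using \<delta>1 \<delta>2 \<delta>3 by (simp add: r_def)
  have ball: "ball xbar r \<subseteq> edom h" using \<delta>2(2) by (auto simp: r_def)
  have lipr: "L-lipschitz_on (ball xbar r) (grad h)"
    by (rule lipschitz_on_subset[OF lip]) (use ball in \<open>auto simp: r_def\<close>)
  have L: "0 \<le> L" using lipr by (rule lipschitz_on_nonneg)
  \<comment> \<open>The second bound keeps \<open>z\<close>, at distance less than \<open>2 * c * norm v\<close> from \<open>x\<close>, inside the ball of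
    radius \<open>r\<close> around \<open>xbar\<close> when \<open>x\<close> lies in the ball of half that radius.\<close>
  define \<eta> where "\<eta> = min e (r / (4 * c))"
  have \<eta>: "0 < \<eta>" using ce r by (simp add: \<eta>_def)
  \<comment> \<open>The value of \<open>norm v * d + L * d\<^sup>2\<close> at \<open>d = 2 * c * norm v\<close>, divided by \<open>(norm v)\<^sup>2\<close>.\<close>
  define K where "K = 2 * c + 4 * L * c\<^sup>2"
  have K: "0 < K" using ce L by (auto simp: K_def intro!: add_pos_nonneg)
  have main: "real_of_ereal (f x - f xbar) \<le> K * (norm v)\<^sup>2"
    if x: "norm (x - xbar) \<le> r / 2" "f xbar < f x" "f x < f xbar + 1"
      and v: "v \<in> subdiff f x" "norm v < \<eta>" for x v
  proof -
    have rv: "v \<in> regular_subdiff f x" using v subdiff by blast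
    have xf: "x \<in> edom h" using rv edom by (auto simp: regular_subdiff_def)
    have "v - grad h x \<in> regular_subdiff P x"
      using rv regular_subdiff_add_smooth[where h=h and P=P, OF h(1) P(1) h(2) xf gderiv_grad[OF h(3) xf]]
      unfolding f_def by blast
    then have res: "norm (prox P (x - grad h x) - x) \<le> norm v"
      by (rule prox_residual_le[OF P])
    \<comment> \<open>Otherwise \<open>x\<close> itself would be a stationary point near \<open>xbar\<close> with a different value.\<close>
    have "v \<noteq> 0"
    proof
      assume "v = 0"
      then have "x \<in> ?X" using v by (simp add: stationary_points_def)
      moreover have "norm (x - xbar) \<le> \<delta>3" using x(1) r by (simp add: r_def)
      ultimately show False using \<delta>3 x(2) by simp
    qed
    have "infdist x ?X \<le> c * norm (prox P (x - grad h x) - x)"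
    proof (rule bound)
      show "norm (prox P (x - grad h x) - x) < e" using res v(2) by (simp add: \<eta>_def)
      show "f x \<le> ereal (fb + 1)" using x(3) fb by (simp add: one_ereal_def less_imp_le)
    qed
    also have "\<dots> \<le> c * norm v" using res ce by simp
    also have "\<dots> < 2 * c * norm v" using ce \<open>v \<noteq> 0\<close> by simp
    finally obtain z where z: "z \<in> ?X" "dist x z < 2 * c * norm v"
      using stat cInf_lessD[of "dist x ` ?X" "2 * c * norm v"]
      by (auto simp: infdist_def split: if_splits)
    have "2 * c * norm v \<le> r / 2"
      using v(2) ce by (simp add: \<eta>_def field_simps)
    then have "dist xbar z < r"
      using z(2) x(1) dist_triangle[of xbar z x] by (simp add: dist_norm norm_minus_commute)
    then have zb: "z \<in> ball xbar r" by simp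
    have xb: "x \<in> ball xbar r" using x(1) r by (simp add: dist_norm norm_minus_commute)
    have "f z = f xbar"
      using \<delta>3(2)[OF z(1)] \<open>dist xbar z < r\<close> by (simp add: r_def dist_norm norm_minus_commute)
    then have "f x \<le> f xbar + ereal (norm v * norm (x - z) + L * (norm (x - z))\<^sup>2)"
      using smooth_convex_gap_le[where h=h and P=P, OF h P(1,2) convex_ball ball lipr xb zb] rv
      unfolding f_def by metis
    then have "real_of_ereal (f x - f xbar) \<le> norm v * norm (x - z) + L * (norm (x - z))\<^sup>2"
      using fb fmin[of x] by (cases "f x") auto
    also have "\<dots> \<le> norm v * (2 * c * norm v) + L * (2 * c * norm v)\<^sup>2"
      using z(2) L by (intro add_mono mult_left_mono power_mono) (auto simp: dist_norm)
    also have "\<dots> = K * (norm v)\<^sup>2"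
      by (simp add: K_def power2_eq_square algebra_simps)
    finally show ?thesis .
  qed
  define C where "C = min \<eta> (1 / sqrt K)"
  have C: "0 < C" "C \<le> \<eta>" "C \<le> 1 / sqrt K"
    using \<eta> K by (auto simp: C_def)
  show ?thesis
  proof (rule KL_property_atI[of C "r / 2" 1])
    fix x v
    assume x: "norm (x - xbar) \<le> r / 2" "f xbar < f x" "f x < f xbar + 1" and v: "v \<in> subdiff f x"
    define d where "d = real_of_ereal (f x - f xbar)"
    have d: "0 < d" "d < 1"
      using real_gap_bounds[OF fmin x(2,3)] by (simp_all add: d_def)
    have "C * sqrt d \<le> norm v"
    proof (cases "norm v < \<eta>")
      case True
      have "sqrt d \<le> sqrt (K * (norm v)\<^sup>2)"
        using main[OF x v True] by (simp add: d_def)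
      then have "sqrt d \<le> sqrt K * norm v" by (simp add: real_sqrt_mult)
      moreover have "C * sqrt d \<le> 1 / sqrt K * sqrt d"
        using C d by (intro mult_right_mono) auto
      moreover have "1 / sqrt K * sqrt d \<le> norm v"
        using K \<open>sqrt d \<le> sqrt K * norm v\<close> by (simp add: pos_divide_le_eq mult.commute)
      ultimately show ?thesis by linarith
    next
      case False
      have "C * sqrt d \<le> \<eta> * 1"
        using C d \<eta> by (intro mult_mono) auto
      with False show ?thesis by simp
    qed
    then show "C * real_of_ereal (f x - f xbar) powr (1 / 2) \<le> norm v"
      using d by (simp add: powr_half_sqrt flip: d_def)
  qed (use C r in auto)
qed

theorem theorem4p1:
  fixes f h P :: "real ^ 'n \<Rightarrow> ereal"
  assumes "\<And>x. f x = h x + P x"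
    and "proper_fun f" and "closed_fun f"
    and "proper_fun h" and "closed_fun h"
    and "open (edom h)" and "smooth_on_dom h"
    and "proper_fun P" and "closed_fun P" and "convex_fun P"
    and "stationary_points f \<noteq> {}"
    and "\<And>xbar. xbar \<in> stationary_points f \<Longrightarrow>
           \<exists>\<delta>>0. \<forall>y. y \<in> stationary_points f \<and> norm (y - xbar) \<le> \<delta> \<longrightarrow> f y = f xbar"
    and "luo_tseng_error_bound h P"
  shows "KL_function f (1/2)"
proof -
  have f: "f = (\<lambda>x. h x + P x)" using assms(1) by blast
  have h: "\<And>z. h z \<noteq> -\<infinity>" and P: "\<And>z. P z \<noteq> -\<infinity>"
    using assms(4,8) by (simp_all add: proper_fun_def)
  note hP = h assms(6,7) P assms(10,9)
  have subdiff: "subdiff f x = regular_subdiff f x" for x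
    unfolding f by (rule subdiff_add_smooth_convex[OF hP])
  have "KL_property_at f (1/2) xbar" if ne: "subdiff f xbar \<noteq> {}" for xbar
  proof (cases "xbar \<in> stationary_points f")
    case True
    then show ?thesis
      using KL_property_at_stationary[OF hP, of xbar] assms(12)[OF True] assms(13) unfolding f
      by blast
  next
    case False
    have xbar: "xbar \<in> edom f" using ne by (auto simp: subdiff_def)
    show ?thesis
    proof (rule KL_property_at_nonstationary)
      fix xs vs v
      assume "xs \<longlonglongrightarrow> xbar" "vs \<longlonglongrightarrow> v" "\<And>k::nat. vs k \<in> subdiff f (xs k)"
      then show "v \<in> subdiff f xbar"
        using subdiff_add_smooth_convex_closed[where h=h and P=P, OF hP] xbar
        unfolding subdiff unfolding f by blast
    qed (use False assms(2) in \<open>auto simp: stationary_points_def proper_fun_def\<close>)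
  qed
  then show ?thesis
    using assms(2,3) by (simp add: KL_function_def)
qed

end
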